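(* Let $K\ge 0$, let $G$ be a graph satisfying the exponential curvature dimension inequality $CDE(n,-K)$, and let $\mu$ be the greatest lower bound of the $\ell^2$-spectrum of the graph Laplacian. Then $$\mu\le Kn.$$
   Context: Graphs: $G=(V,E)$ is a locally finite, connected graph with a symmetric weight $\mu_{\cdot\cdot}:V\times V\to[0,\infty)$, $\mu_{xy}>0$ iff $x\sim y$ (neighbors), $\inf_{(x,y)\in E}\mu_{xy}>0$, $\deg(x):=\sum_{y}\mu_{xy}<\infty$. $m:V\to(0,\infty)$ is a measure on vertices. $D_\mu:=\max_{(x,y)\in E}\deg(x)/\mu_{xy}$ and $D_m:=\max_{x\in V}\deg(x)/m(x)$ are finite. Laplacian: $\Delta f(x)=\frac1{m(x)}\sum_{y}\mu_{xy}(f(y)-f(x))$. $\mu$ (without indices) is the infimum of the spectrum of the nonnegative self-adjoint operator $-\Delta$ on $\ell^2(V,m)$. Curvature: $\Gamma(f,g)=\frac12(\Delta(fg)-f\Delta g-g\Delta f)$, $\Gamma_2(f,g)=\frac12(\Delta\Gamma(f,g)-\Gamma(f,\Delta g)-\Gamma(\Delta f,g))$, $\Gamma(f)=\Gamma(f,f)$, $\Gamma_2(f)=\Gamma_2(f,f)$. For $n>0$ and $\kappa\in\mathbb R$, $G$ satisfies $CDE(n,\kappa)$ if for every vertex $x$ and every positive $f:V\to\mathbb R$ with $\Delta f(x)<0$ one has, at $x$, $\Gamma_2(f)-\Gamma\bigl(f,\frac{\Gamma(f)}{f}\bigr)\ge\frac1n(\Delta f)^2+\kappa\,\Gamma(f)$.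 *)

theory Defs
  imports "HOL-Analysis.Analysis"
begin

text \<open>
  The vertex set is the type \<open>'v\<close>. The weight \<open>w x y\<close> is positive exactly when \<open>x\<close> and \<open>y\<close> are
  neighbours, so \<open>w\<close> determines the edge set.
\<close>

definition neighbors :: "('v \<Rightarrow> 'v \<Rightarrow> real) \<Rightarrow> 'v \<Rightarrow> 'v set" where
  "neighbors w x = {y. w x y > 0}"

definition edges :: "('v \<Rightarrow> 'v \<Rightarrow> real) \<Rightarrow> ('v \<times> 'v) set" where
  "edges w = {(x, y). w x y > 0}"

definition deg :: "('v \<Rightarrow> 'v \<Rightarrow> real) \<Rightarrow> 'v \<Rightarrow> real" where
  "deg w x = (\<Sum>y\<in>neighbors w x. w x y)"

text \<open>
  The condition \<open>inf_weight\<close> says that the infimum of the edge weights is positive (this form also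
  covers a graph without edges). The last two conditions say that $D_\mu$ and $D_m$ are finite.
\<close>

locale weighted_graph =
  fixes w :: "'v \<Rightarrow> 'v \<Rightarrow> real" and m :: "'v \<Rightarrow> real"
  assumes weight_nonneg: "0 \<le> w x y"
    and weight_sym: "w x y = w y x"
    and locally_finite: "finite (neighbors w x)"
    and connected: "(x, y) \<in> (edges w)\<^sup>*"
    and inf_weight: "\<exists>c>0. \<forall>(x, y)\<in>edges w. c \<le> w x y"
    and measure_pos: "0 < m x"
    and D_mu_finite: "bdd_above ((\<lambda>(x, y). deg w x / w x y) ` edges w)"
    and D_m_finite: "bdd_above (range (\<lambda>x. deg w x / m x))"

text \<open>
  The value type is left open because the curvature condition concerns real functions and the
  spectrum concerns complex ones.
\<close>

definition laplacian ::
    "('v \<Rightarrow> 'v \<Rightarrow> real) \<Rightarrow> ('v \<Rightarrow> real) \<Rightarrow> ('v \<Rightarrow> 'b::real_vector) \<Rightarrow> 'v \<Rightarrow> 'b" where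
  "laplacian w m f x = (1 / m x) *\<^sub>R (\<Sum>y\<in>neighbors w x. w x y *\<^sub>R (f y - f x))"

definition \<Gamma> ::
    "('v \<Rightarrow> 'v \<Rightarrow> real) \<Rightarrow> ('v \<Rightarrow> real) \<Rightarrow> ('v \<Rightarrow> real) \<Rightarrow> ('v \<Rightarrow> real) \<Rightarrow> 'v \<Rightarrow> real" where
  "\<Gamma> w m f g x =
     (1 / 2) * (laplacian w m (\<lambda>y. f y * g y) x - f x * laplacian w m g x - g x * laplacian w m f x)"

definition \<Gamma>2 ::
    "('v \<Rightarrow> 'v \<Rightarrow> real) \<Rightarrow> ('v \<Rightarrow> real) \<Rightarrow> ('v \<Rightarrow> real) \<Rightarrow> ('v \<Rightarrow> real) \<Rightarrow> 'v \<Rightarrow> real" where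
  "\<Gamma>2 w m f g x =
     (1 / 2) * (laplacian w m (\<Gamma> w m f g) x
                - \<Gamma> w m f (laplacian w m g) x - \<Gamma> w m (laplacian w m f) g x)"

definition CDE :: "('v \<Rightarrow> 'v \<Rightarrow> real) \<Rightarrow> ('v \<Rightarrow> real) \<Rightarrow> real \<Rightarrow> real \<Rightarrow> bool" where
  "CDE w m n \<kappa> \<longleftrightarrow>
     (\<forall>x f. (\<forall>y. 0 < f y) \<longrightarrow> laplacian w m f x < 0 \<longrightarrow>
        \<Gamma>2 w m f f x - \<Gamma> w m f (\<lambda>y. \<Gamma> w m f f y / f y) x
          \<ge> (1 / n) * (laplacian w m f x)\<^sup>2 + \<kappa> * \<Gamma> w m f f x)"

definition l2 :: "('v \<Rightarrow> real) \<Rightarrow> ('v \<Rightarrow> complex) set" where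
  "l2 m = {f. (\<lambda>x. m x * (cmod (f x))\<^sup>2) summable_on UNIV}"

definition l2_norm :: "('v \<Rightarrow> real) \<Rightarrow> ('v \<Rightarrow> complex) \<Rightarrow> real" where
  "l2_norm m f = sqrt (\<Sum>\<^sub>\<infinity>x. m x * (cmod (f x))\<^sup>2)"

text \<open>
  For an operator \<open>T\<close> that is defined on all of \<open>l2 m\<close>, the point \<open>z\<close> lies in the resolvent set iff
  \<open>T - z\<close> is a bijection of \<open>l2 m\<close> whose inverse is bounded; the bound is stated here as
  $\|f\| \le C \|(T - z) f\|$. The Laplacian is everywhere defined (and bounded) on \<open>l2 m\<close> because
  $D_m$ is finite.
\<close>

definition l2_resolvent_set ::
    "('v \<Rightarrow> real) \<Rightarrow> (('v \<Rightarrow> complex) \<Rightarrow> ('v \<Rightarrow> complex)) \<Rightarrow> complex set" where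
  "l2_resolvent_set m T =
     {z. bij_betw (\<lambda>f x. T f x - z * f x) (l2 m) (l2 m) \<and>
         (\<exists>C. \<forall>f\<in>l2 m. l2_norm m f \<le> C * l2_norm m (\<lambda>x. T f x - z * f x))}"

definition l2_spectrum ::
    "('v \<Rightarrow> real) \<Rightarrow> (('v \<Rightarrow> complex) \<Rightarrow> ('v \<Rightarrow> complex)) \<Rightarrow> complex set" where
  "l2_spectrum m T = - l2_resolvent_set m T"

text \<open>
  Since $-\Delta$ is bounded, self-adjoint and nonnegative, its spectrum is a nonempty subset of
  $[0, \infty)$, so the infimum is taken over the real numbers in the spectrum.
\<close>

definition spectrum_inf :: "('v \<Rightarrow> 'v \<Rightarrow> real) \<Rightarrow> ('v \<Rightarrow> real) \<Rightarrow> real" where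
  "spectrum_inf w m =
     Inf {t. complex_of_real t \<in> l2_spectrum m (\<lambda>f x. - laplacian w m f x)}"

end

theory Submission
  imports Defs
begin

text \<open>
  Let $\rho$ be the infimum of the Rayleigh quotients $\langle -\Delta u, u\rangle / \|u\|^2$ over
  finitely supported $u$; it is a spectral value, so $\mu \le \rho$. On an infinite graph every
  $\lambda \in (0, \rho)$ admits a positive solution of $\Delta\varphi = -\lambda\varphi$, a limit of
  normalised Green's functions. For $f = \sqrt\varphi$ and $G = \Gamma(f)/f^2$ one has
  $\Delta f = -(\lambda/2 + G) f$ and $\Delta f + \Gamma(f)/f = -(\lambda/2) f$, so at a maximum of $G$
  the curvature condition reads $(\lambda/2 + G)^2 \le nKG$; since the left side is at least
  $2 \lambda G$ and positive, this gives $\lambda \le nK$. On a finite graph $\rho = 0$.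
\<close>

text \<open>The left side of the curvature condition equals \<Delta>\<Gamma>(f)/2 - \<Gamma>(f,
  \<Delta>f + \<Gamma>(f)/f). For the square root of a solution the second argument is a multiple of
  f, so this becomes \<Delta>\<Gamma>(f)/2 + (\<lambda>/2) \<Gamma>(f). As \<Gamma>(f) = G \<phi>,
  at a maximum of G one has \<Delta>\<Gamma>(f) \<le> G \<Delta>\<phi> = -\<lambda> G \<phi>, and
  the two terms cancel.

  The bottom of the spectrum need not be an eigenvalue, so \<phi> cannot be expected in l2. It is
  built strictly below \<rho>, where the gap \<rho> - \<lambda> in the form inequality controls
  Green's functions.

  On the spectral side only \<mu> \<le> \<rho> is needed, and no spectral theorem: a form estimate
  shows that a resolvent at \<rho> would improve the optimal constant, and a lower bound on the real
  spectral values makes the infimum meaningful.\<close>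

section \<open>Discrete calculus: the Laplacian and \<Gamma> as edge sums\<close>

lemma laplacian_real: "laplacian w m f x = (\<Sum>y\<in>neighbors w x. w x y * (f y - f x)) / m x"
  for f :: "'v \<Rightarrow> real"
  by (simp add: laplacian_def)

text \<open>The product rule for differences turns the bracket into an edge sum, from which
  bilinearity and \<Gamma>(f) \<ge> 0 can be read off.\<close>

lemma \<Gamma>_eq:
  "\<Gamma> w m f g x = (\<Sum>y\<in>neighbors w x. w x y * ((f y - f x) * (g y - g x))) / (2 * m x)"
proof -
  have "(\<Sum>y\<in>neighbors w x. w x y * ((f y - f x) * (g y - g x))) =
      (\<Sum>y\<in>neighbors w x. w x y * (f y * g y - f x * g x))
      - f x * (\<Sum>y\<in>neighbors w x. w x y * (g y - g x))
      - g x * (\<Sum>y\<in>neighbors w x. w x y * (f y - f x))"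
    unfolding sum_distrib_left sum_subtractf[symmetric]
    by (intro sum.cong) (auto simp: algebra_simps)
  then show ?thesis
    unfolding \<Gamma>_def laplacian_real by (simp add: diff_divide_distrib)
qed

lemma \<Gamma>_commute: "\<Gamma> w m f g x = \<Gamma> w m g f x"
  by (simp add: \<Gamma>_eq mult.commute)

lemma \<Gamma>_add_right: "\<Gamma> w m f (\<lambda>y. g y + h y) x = \<Gamma> w m f g x + \<Gamma> w m f h x"
  unfolding \<Gamma>_eq add_divide_distrib[symmetric] sum.distrib[symmetric]
  by (intro arg_cong2[of _ _ _ _ "(/)"] sum.cong) (auto simp: algebra_simps)

lemma \<Gamma>_scale_right: "\<Gamma> w m f (\<lambda>y. c * g y) x = c * \<Gamma> w m f g x"
  unfolding \<Gamma>_eq times_divide_eq_right sum_distrib_left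
  by (intro arg_cong2[of _ _ _ _ "(/)"] sum.cong) (auto simp: algebra_simps)

context weighted_graph
begin

text \<open>Weights vanish off the neighbourhood, so finite support lets all neighbourhoods be
  replaced by one common set \<open>S\<close>; double sums over \<open>S\<close> can then be
  swapped.\<close>

lemma sum_neighbors_eq:
  fixes g :: "'v \<Rightarrow> real"
  assumes "finite S" "\<And>y. y \<notin> S \<Longrightarrow> g y = 0"
  shows "(\<Sum>y\<in>neighbors w x. w x y * g y) = (\<Sum>y\<in>S. w x y * g y)"
proof (rule sum.mono_neutral_cong)
  fix y assume "y \<in> S - neighbors w x"
  then have "w x y = 0" using weight_nonneg[of x y] by (auto simp: neighbors_def)
  then show "w x y * g y = 0" by simp
qed (use assms locally_finite in auto)

lemma sum_le_sum_neighbors: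
  fixes g :: "'v \<Rightarrow> real"
  assumes "finite S" "\<And>y. 0 \<le> g y"
  shows "(\<Sum>y\<in>S. w x y * g y) \<le> (\<Sum>y\<in>neighbors w x. w x y * g y)"
proof -
  have "(\<Sum>y\<in>S. w x y * g y) = (\<Sum>y\<in>S. w x y * (if y \<in> S then g y else 0))"
    by (rule sum.cong) auto
  also have "\<dots> = (\<Sum>y\<in>neighbors w x. w x y * (if y \<in> S then g y else 0))"
    by (rule sum_neighbors_eq[symmetric]) (use assms in auto)
  also have "\<dots> \<le> (\<Sum>y\<in>neighbors w x. w x y * g y)"
    by (rule sum_mono) (use assms weight_nonneg in \<open>auto intro: mult_left_mono\<close>)
  finally show ?thesis .
qed

lemma sum_weight_le_deg: "finite S \<Longrightarrow> (\<Sum>y\<in>S. w x y) \<le> deg w x"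
  using sum_le_sum_neighbors[of S "\<lambda>_. 1" x] by (simp add: deg_def)

lemma deg_nonneg: "0 \<le> deg w x"
  by (simp add: deg_def sum_nonneg weight_nonneg)

lemma laplacian_eq_deg:
  fixes f :: "'v \<Rightarrow> real"
  shows "m x * laplacian w m f x = (\<Sum>y\<in>neighbors w x. w x y * f y) - deg w x * f x"
proof -
  have "m x * laplacian w m f x = (\<Sum>y\<in>neighbors w x. w x y * (f y - f x))"
    using measure_pos[of x] by (simp add: laplacian_real)
  then show ?thesis
    by (simp add: deg_def right_diff_distrib sum_subtractf sum_distrib_right)
qed

lemma deg_le_measure: "\<exists>D>0. \<forall>x. deg w x \<le> D * m x"
proof -
  from D_m_finite obtain B where B: "\<And>x. deg w x / m x \<le> B"
    by (auto simp: bdd_above_def)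
  have "deg w x \<le> max B 1 * m x" for x
  proof -
    have "deg w x \<le> B * m x" using B[of x] measure_pos[of x] by (simp add: field_simps)
    also have "\<dots> \<le> max B 1 * m x" using measure_pos[of x] by (intro mult_right_mono) auto
    finally show ?thesis .
  qed
  then show ?thesis by (intro exI[of _ "max B 1"]) auto
qed

section \<open>The Dirichlet form and its best lower bound\<close>

definition mass :: "'v set \<Rightarrow> ('v \<Rightarrow> real) \<Rightarrow> real" where
  "mass S u = (\<Sum>x\<in>S. m x * (u x)\<^sup>2)"

text \<open>The Dirichlet form on functions extended by zero outside \<open>S\<close>.\<close>

definition dform :: "'v set \<Rightarrow> ('v \<Rightarrow> real) \<Rightarrow> ('v \<Rightarrow> real) \<Rightarrow> real" where
  "dform S u v = (\<Sum>x\<in>S. deg w x * u x * v x) - (\<Sum>x\<in>S. \<Sum>y\<in>S. w x y * u y * v x)"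

text \<open>The form inequality -\<Delta> \<ge> r on finitely supported functions. Values of
  \<open>u\<close> off \<open>S\<close> do not enter, so \<open>u\<close> may be any function. The
  Rayleigh infimum \<rho> is the largest such \<open>r\<close>.\<close>

definition coercive :: "real \<Rightarrow> bool" where
  "coercive r \<longleftrightarrow> (\<forall>S u. finite S \<longrightarrow> r * mass S u \<le> dform S u u)"

lemma mass_nonneg: "0 \<le> mass S u"
  unfolding mass_def by (intro sum_nonneg mult_nonneg_nonneg) (auto simp: less_imp_le[OF measure_pos])

text \<open>AM-GM on each pair, plus symmetry of \<open>w\<close>. The absolute value serves both
  ends: nonnegativity of the Dirichlet form and its upper bound.\<close>

lemma abs_cross_sum_le:
  assumes "finite S"
  shows "\<bar>\<Sum>x\<in>S. \<Sum>y\<in>S. w x y * u y * u x\<bar> \<le> (\<Sum>x\<in>S. deg w x * (u x)\<^sup>2)"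
proof -
  have le: "\<bar>w x y * u y * u x\<bar> \<le> w x y * (u x)\<^sup>2 / 2 + w x y * (u y)\<^sup>2 / 2" for x y
  proof -
    have "\<bar>u y * u x\<bar> \<le> ((u x)\<^sup>2 + (u y)\<^sup>2) / 2"
      using sum_squares_bound[of "\<bar>u y\<bar>" "\<bar>u x\<bar>"] by (simp add: abs_mult)
    from mult_left_mono[OF this weight_nonneg[of x y]] show ?thesis
      using weight_nonneg[of x y] by (simp add: abs_mult algebra_simps)
  qed
  have "\<bar>\<Sum>x\<in>S. \<Sum>y\<in>S. w x y * u y * u x\<bar> \<le> (\<Sum>x\<in>S. \<Sum>y\<in>S. \<bar>w x y * u y * u x\<bar>)"
    by (rule order_trans[OF sum_abs sum_mono[OF sum_abs]])
  also have "\<dots> \<le> (\<Sum>x\<in>S. \<Sum>y\<in>S. w x y * (u x)\<^sup>2 / 2 + w x y * (u y)\<^sup>2 / 2)"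
    by (intro sum_mono le)
  also have "\<dots> = (\<Sum>x\<in>S. \<Sum>y\<in>S. w x y * (u x)\<^sup>2 / 2) + (\<Sum>x\<in>S. \<Sum>y\<in>S. w x y * (u y)\<^sup>2 / 2)"
    by (simp add: sum.distrib)
  also have "(\<Sum>x\<in>S. \<Sum>y\<in>S. w x y * (u y)\<^sup>2 / 2) = (\<Sum>x\<in>S. \<Sum>y\<in>S. w x y * (u x)\<^sup>2 / 2)"
    by (subst sum.swap) (simp add: weight_sym)
  also have "(\<Sum>x\<in>S. \<Sum>y\<in>S. w x y * (u x)\<^sup>2 / 2) + (\<Sum>x\<in>S. \<Sum>y\<in>S. w x y * (u x)\<^sup>2 / 2)
      = (\<Sum>x\<in>S. (\<Sum>y\<in>S. w x y) * (u x)\<^sup>2)"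
    unfolding sum.distrib[symmetric] sum_distrib_right by simp
  also have "\<dots> \<le> (\<Sum>x\<in>S. deg w x * (u x)\<^sup>2)"
    by (intro sum_mono mult_right_mono sum_weight_le_deg assms) auto
  finally show ?thesis .
qed

lemma coercive_0: "coercive 0"
  unfolding coercive_def
proof safe
  fix S :: "'v set" and u :: "'v \<Rightarrow> real" assume "finite S"
  from abs_cross_sum_le[OF this, of u]
  show "0 * mass S u \<le> dform S u u"
    by (simp add: dform_def power2_eq_square mult.assoc)
qed

lemma dform_le_mass:
  assumes "finite S" and D: "\<And>x. deg w x \<le> D * m x"
  shows "dform S u u \<le> 2 * D * mass S u"
proof -
  have "(\<Sum>x\<in>S. deg w x * (u x)\<^sup>2) \<le> D * mass S u"
    unfolding mass_def sum_distrib_left mult.assoc[symmetric]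
    by (intro sum_mono mult_right_mono D) auto
  then show ?thesis
    using abs_cross_sum_le[OF assms(1), of u] by (simp add: dform_def power2_eq_square mult.assoc)
qed

text \<open>Test with the indicator of \<open>x\<close>; a loop at \<open>x\<close> only lowers its
  energy. This gives the Green iteration a positive denominator and bounds the admissible
  \<open>r\<close>.\<close>

lemma coercive_imp_le_deg:
  assumes "coercive r"
  shows "r * m x \<le> deg w x"
proof -
  have "r * mass {x} (\<lambda>_. 1) \<le> dform {x} (\<lambda>_. 1) (\<lambda>_. 1)"
    using assms unfolding coercive_def by blast
  then show ?thesis using weight_nonneg[of x x] by (simp add: mass_def dform_def)
qed

text \<open>Only \<open>u\<close> has to vanish off \<open>S\<close>, so the identity can be tested
  with v = -\<Delta>u - r u, whose support may be larger.\<close>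

lemma sum_laplacian_eq_dform:
  fixes u v :: "'v \<Rightarrow> real"
  assumes "finite S" "\<And>y. y \<notin> S \<Longrightarrow> u y = 0"
  shows "(\<Sum>x\<in>S. m x * (- laplacian w m u x) * v x) = dform S u v"
proof -
  have "m x * (- laplacian w m u x) = deg w x * u x - (\<Sum>y\<in>S. w x y * u y)" for x
    using laplacian_eq_deg[of x u] sum_neighbors_eq[of S u x] assms by simp
  then show ?thesis
    by (simp only: dform_def sum_subtractf left_diff_distrib sum_distrib_right)
qed

lemma dform_sym: "dform S u v = dform S v u"
proof -
  have "(\<Sum>x\<in>S. \<Sum>y\<in>S. w x y * u y * v x) = (\<Sum>x\<in>S. \<Sum>y\<in>S. w x y * v y * u x)"
    by (subst sum.swap) (simp add: weight_sym mult_ac)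
  then show ?thesis by (simp add: dform_def mult_ac)
qed

lemma dform_diff_scale:
  "dform S (\<lambda>x. u x - t * v x) (\<lambda>x. u x - t * v x)
    = dform S u u - 2 * t * dform S u v + t\<^sup>2 * dform S v v"
proof -
  have lin: "dform S a (\<lambda>x. b x - t * c x) = dform S a b - t * dform S a c" for a b c
    by (simp add: dform_def sum_subtractf right_diff_distrib sum_distrib_left mult_ac)
  show ?thesis
    by (simp add: lin dform_sym[of S "\<lambda>x. u x - t * v x"] dform_sym[of S v u] power2_eq_square
        algebra_simps)
qed

lemma mass_diff_scale:
  "mass S (\<lambda>x. u x - t * v x)
    = mass S u - 2 * t * (\<Sum>x\<in>S. m x * u x * v x) + t\<^sup>2 * mass S v"
  unfolding mass_def sum_distrib_left sum_subtractf[symmetric] sum.distrib[symmetric]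
  by (intro sum.cong) (auto simp: power2_eq_square algebra_simps)

text \<open>
  With $B = -\Delta - r \ge 0$, the inequality
  $0 \le \langle B(u - tBu), u - tBu\rangle$ at $t = 1/(2D)$ gives $\|Bu\|^2 \le 2D\,\langle Bu, u\rangle$.
\<close>

lemma mass_shifted_laplacian_le:
  fixes u :: "'v \<Rightarrow> real"
  assumes r: "coercive r" "0 \<le> r" and D: "0 < D" "\<And>x. deg w x \<le> D * m x"
    and S: "finite S" "\<And>y. y \<notin> S \<Longrightarrow> u y = 0"
  shows "mass S (\<lambda>x. - laplacian w m u x - r * u x) \<le> 2 * D * (dform S u u - r * mass S u)"
proof -
  define v where "v = (\<lambda>x. - laplacian w m u x - r * u x)"
  \<comment> \<open>This value maximises 2t - 2Dt^2, the coefficient of \<open>mass S v\<close> once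
    the last term is estimated by \<open>dform_le_mass\<close>.\<close>
  define t where "t = 1 / (2 * D)"
  have t: "0 < t" "2 * D * t = 1" using D(1) by (auto simp: t_def)
  have v: "dform S u v - r * (\<Sum>x\<in>S. m x * u x * v x) = mass S v"
  proof -
    have "dform S u v = (\<Sum>x\<in>S. m x * (- laplacian w m u x) * v x)"
      using sum_laplacian_eq_dform[of S u v] S by simp
    then show ?thesis
      by (simp add: mass_def sum_distrib_left sum_subtractf[symmetric])
        (simp add: v_def power2_eq_square algebra_simps)
  qed
  have "r * mass S (\<lambda>x. u x - t * v x) \<le> dform S (\<lambda>x. u x - t * v x) (\<lambda>x. u x - t * v x)"
    using r(1) S(1) by (simp add: coercive_def)
  then have "0 \<le> (dform S u u - r * mass S u) - 2 * t * (dform S u v - r * (\<Sum>x\<in>S. m x * u x * v x))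
      + t\<^sup>2 * (dform S v v - r * mass S v)"
    by (simp add: dform_diff_scale mass_diff_scale algebra_simps)
  also have "t\<^sup>2 * (dform S v v - r * mass S v) \<le> t\<^sup>2 * (2 * D * mass S v)"
    using dform_le_mass[OF S(1) D(2), of v] mult_nonneg_nonneg[OF r(2) mass_nonneg[of S v]]
    by (intro mult_left_mono) auto
  also have "t\<^sup>2 * (2 * D * mass S v) = t * mass S v"
  proof -
    have "t\<^sup>2 * (2 * D * mass S v) = (2 * D * t) * (t * mass S v)"
      by (simp add: power2_eq_square)
    then show ?thesis by (simp add: t(2))
  qed
  finally have "t * mass S v \<le> dform S u u - r * mass S u" by (simp add: v)
  from mult_left_mono[OF this, of "2 * D"] show ?thesis
    using t D(1) by (simp add: v_def mult.assoc[symmetric])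
qed


section \<open>Green's functions below the best constant\<close>

text \<open>
  Monotone iteration from $0$; testing the $k$-th iterate against the Dirichlet form bounds its
  mass uniformly in $k$.
\<close>

lemma green_function_exists:
  assumes r: "coercive r" and l: "l < r"
  shows "\<exists>u. (\<forall>x. 0 \<le> u x) \<and> 0 < u a \<and>
    (\<forall>x. (deg w x - l * m x) * u x = (if x = a then 1 else 0) + (\<Sum>y\<in>neighbors w x. w x y * u y))"
proof -
  define c where "c = (\<lambda>x. deg w x - l * m x)"
  define \<delta> where "\<delta> = (\<lambda>x. if x = a then 1 else (0::real))"
  \<comment> \<open>The equation m(-\<Delta> - l)u = \<delta> solved for the \<open>u x\<close>
    multiplied by \<open>c x\<close>, a Jacobi-type iteration. It is monotone since \<open>w\<close>
    is nonnegative and \<open>c\<close> positive.\<close>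
  define T where "T = (\<lambda>u x. (\<delta> x + (\<Sum>y\<in>neighbors w x. w x y * u y)) / c x)"
  define U where "U = (\<lambda>k. (T ^^ k) (\<lambda>_. 0))"
  have c: "0 < c x" for x
    using coercive_imp_le_deg[OF r, of x] mult_strict_right_mono[OF l measure_pos[of x]]
    by (simp add: c_def)
  have U0: "U 0 x = 0" for x by (simp add: U_def)
  have USuc: "c x * U (Suc k) x = \<delta> x + (\<Sum>y\<in>neighbors w x. w x y * U k y)" for k x
    using c[of x] by (simp add: U_def T_def)
  have nonneg: "0 \<le> U k x" for k x
  proof (induction k arbitrary: x)
    case (Suc k)
    have "0 \<le> c x * U (Suc k) x"
      unfolding USuc by (intro add_nonneg_nonneg sum_nonneg mult_nonneg_nonneg Suc weight_nonneg)
        (simp add: \<delta>_def)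
    then show ?case using c[of x] by (simp add: zero_le_mult_iff)
  qed (simp add: U0)
  have step: "U k x \<le> U (Suc k) x" for k x
  proof (induction k arbitrary: x)
    case (Suc k)
    have "c x * U (Suc k) x \<le> c x * U (Suc (Suc k)) x"
      unfolding USuc by (intro add_left_mono sum_mono mult_left_mono Suc weight_nonneg)
    then show ?case using c[of x] by simp
  qed (simp add: U0 nonneg)
  \<comment> \<open>Finite support is what allows coercivity to be applied to the iterates.\<close>
  have supp: "\<exists>S. finite S \<and> (\<forall>y. y \<notin> S \<longrightarrow> U k y = 0)" for k
  proof (induction k)
    case 0
    show ?case by (intro exI[of _ "{}"]) (simp add: U0)
  next
    case (Suc k)
    then obtain S where S: "finite S" "\<And>y. y \<notin> S \<Longrightarrow> U k y = 0" by blast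
    have "U (Suc k) x = 0" if x: "x \<notin> {a} \<union> (\<Union>y\<in>S. neighbors w y)" for x
    proof -
      have "U k y = 0" if "y \<in> neighbors w x" for y
        using that x S(2) weight_sym[of x y] by (auto simp: neighbors_def)
      then have "c x * U (Suc k) x = 0" using x by (simp add: USuc \<delta>_def)
      then show ?thesis using c[of x] by simp
    qed
    then show ?case
      using S(1) locally_finite by (intro exI[of _ "{a} \<union> (\<Union>y\<in>S. neighbors w y)"]) auto
  qed
  have mass_bound: "(r - l) * (m x * (U k x)\<^sup>2) \<le> U k a" for k x
  proof -
    obtain S0 where S0: "finite S0" "\<And>y. y \<notin> S0 \<Longrightarrow> U k y = 0" using supp[of k] by blast
    define S where "S = insert a (insert x S0)"
    have S: "finite S" "\<And>y. y \<notin> S \<Longrightarrow> U k y = 0" "x \<in> S" "a \<in> S" using S0 by (auto simp: S_def)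
    have "m x * (U k x)\<^sup>2 \<le> mass S (U k)"
      unfolding mass_def
      by (rule member_le_sum) (use S measure_pos in \<open>auto intro!: mult_nonneg_nonneg simp: less_imp_le\<close>)
    then have "(r - l) * (m x * (U k x)\<^sup>2) \<le> (r - l) * mass S (U k)"
      using l by (intro mult_left_mono) auto
    also have "\<dots> \<le> dform S (U k) (U k) - l * mass S (U k)"
      using r S(1) by (simp add: coercive_def left_diff_distrib)
    also have "dform S (U k) (U k) = (\<Sum>x\<in>S. m x * (- laplacian w m (U k) x) * U k x)"
      using sum_laplacian_eq_dform[of S "U k" "U k"] S by simp
    also have "\<dots> - l * mass S (U k)
        = (\<Sum>x\<in>S. (c x * U k x - (\<Sum>y\<in>neighbors w x. w x y * U k y)) * U k x)"
      unfolding mass_def sum_distrib_left sum_subtractf[symmetric]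
    proof (rule sum.cong)
      fix x
      show "m x * - laplacian w m (U k) x * U k x - l * (m x * (U k x)\<^sup>2) =
         (c x * U k x - (\<Sum>y\<in>neighbors w x. w x y * U k y)) * U k x"
        using laplacian_eq_deg[of x "U k"]
        by (simp add: c_def power2_eq_square) (simp add: algebra_simps)
    qed simp
    \<comment> \<open>Since \<open>U k\<close> \<le> \<open>U (Suc k)\<close>, each iterate is a
      subsolution, so its energy shifted by \<open>l\<close> is at most its pairing with the point
      source.\<close>
    also have "\<dots> \<le> (\<Sum>x\<in>S. \<delta> x * U k x)"
    proof (intro sum_mono mult_right_mono nonneg)
      fix x
      have "c x * U k x \<le> c x * U (Suc k) x" using c[of x] step[of k x] by simp
      then show "c x * U k x - (\<Sum>y\<in>neighbors w x. w x y * U k y) \<le> \<delta> x" by (simp add: USuc)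
    qed
    also have "\<dots> = U k a"
      using S(1,4) by (simp add: \<delta>_def if_distrib[of "\<lambda>z. z * _"] sum.delta cong: if_cong)
    finally show ?thesis .
  qed
  \<comment> \<open>At \<open>x = a\<close> the mass bound is quadratic in \<open>U k a\<close> on
    the left and linear on the right, so it bounds \<open>U k a\<close> itself.\<close>
  define B where "B = 1 / ((r - l) * m a)"
  have rl: "0 < (r - l) * m x" for x using l measure_pos[of x] by simp
  have Ba: "U k a \<le> B" for k
  proof (cases "U k a = 0")
    case True
    then show ?thesis using rl[of a] by (simp add: B_def)
  next
    case False
    then have pos: "0 < U k a" using nonneg[of k a] by simp
    have "((r - l) * m a * U k a) * U k a \<le> 1 * U k a"
      using mass_bound[of a k] by (simp add: power2_eq_square algebra_simps)
    then have "(r - l) * m a * U k a \<le> 1" using pos by (simp only: mult_le_cancel_right)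
    then show ?thesis using rl[of a] by (simp add: B_def field_simps)
  qed
  have bound: "U k x \<le> 1 + B / ((r - l) * m x)" for k x
  proof -
    have "(r - l) * m x * (U k x)\<^sup>2 \<le> B" using mass_bound[of x k] Ba[of k] by (simp add: mult.assoc)
    then have "(U k x)\<^sup>2 \<le> B / ((r - l) * m x)" using rl[of x] by (simp add: field_simps)
    moreover have "U k x \<le> 1 + (U k x)\<^sup>2"
      using self_le_power[of "U k x" 2]
      by (cases "U k x \<le> 1") (auto intro: add_increasing2 add_increasing)
    ultimately show ?thesis by linarith
  qed
  have "\<exists>L. (\<lambda>k. U k x) \<longlonglongrightarrow> L" for x
  proof -
    have "incseq (\<lambda>k. U k x)" using step by (simp add: incseq_Suc_iff)
    from incseq_convergent[OF this, of "1 + B / ((r - l) * m x)"] bound show ?thesis by blast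
  qed
  then obtain u where u: "\<And>x. (\<lambda>k. U k x) \<longlonglongrightarrow> u x" by metis
  have u0: "0 \<le> u x" for x
    by (rule LIMSEQ_le_const[OF u]) (use nonneg in auto)
  have eq: "c x * u x = \<delta> x + (\<Sum>y\<in>neighbors w x. w x y * u y)" for x
  proof (rule LIMSEQ_unique)
    show "(\<lambda>k. c x * U (Suc k) x) \<longlonglongrightarrow> c x * u x"
      by (intro tendsto_intros LIMSEQ_Suc[OF u])
    show "(\<lambda>k. c x * U (Suc k) x) \<longlonglongrightarrow> \<delta> x + (\<Sum>y\<in>neighbors w x. w x y * u y)"
      unfolding USuc by (intro tendsto_intros u)
  qed
  have "0 < c a * u a"
    unfolding eq
    by (intro add_pos_nonneg sum_nonneg mult_nonneg_nonneg u0 weight_nonneg) (simp add: \<delta>_def)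
  then have "0 < u a" using c[of a] by (simp add: zero_less_mult_iff)
  then show ?thesis
    by (intro exI[of _ u] conjI allI u0 eq[unfolded c_def \<delta>_def])
qed

section \<open>Harnack inequality and positive solutions\<close>

text \<open>One term of the inequality \<Delta>u \<le> 0, kept for each edge separately. Green's
  functions with \<open>l\<close> \<ge> 0 satisfy it even at the pole.\<close>

definition supersolution :: "('v \<Rightarrow> real) \<Rightarrow> bool" where
  "supersolution u \<longleftrightarrow> (\<forall>x. 0 \<le> u x) \<and> (\<forall>x y. w x y * u y \<le> deg w x * u x)"

text \<open>The edge bounds multiply along a path. The constant depends on the path but not on
  \<open>u\<close>; compactness needs this uniformity over the whole family of Green's
  functions.\<close>

lemma harnack: "\<exists>C>0. \<forall>u. supersolution u \<longrightarrow> u y \<le> C * u x"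
  using connected[of x y]
proof (induction rule: rtrancl_induct)
  case base
  show ?case by (intro exI[of _ 1]) auto
next
  case (step y z)
  then obtain C where C: "C > 0" "\<And>u. supersolution u \<Longrightarrow> u y \<le> C * u x" by blast
  have e: "0 < w y z" using step by (simp add: edges_def)
  define E where "E = deg w y / w y z + 1"
  have E: "0 < E" using e deg_nonneg[of y] by (simp add: E_def add_nonneg_pos)
  have "u z \<le> (E * C) * u x" if u: "supersolution u" for u
  proof -
    have uy: "0 \<le> u y" "w y z * u z \<le> deg w y * u y" using u by (auto simp: supersolution_def)
    then have "u z \<le> deg w y / w y z * u y" using e by (simp add: field_simps)
    also have "\<dots> \<le> E * u y" using uy by (intro mult_right_mono) (auto simp: E_def)
    also have "\<dots> \<le> E * (C * u x)" using C(2)[OF u] E by (intro mult_left_mono) auto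
    finally show ?thesis by simp
  qed
  then show ?case using C(1) E by (intro exI[of _ "E * C"]) auto
qed

text \<open>
  Green's functions with pole outside a given finite set, normalised at a base point, solve the
  equation on that set; by Harnack they lie in a fixed product of compact intervals, so Tychonoff's
  theorem provides a global solution.
\<close>

lemma positive_solution_exists:
  assumes r: "coercive r" and l: "0 \<le> l" "l < r" and inf: "infinite (UNIV :: 'v set)"
  shows "\<exists>f. (\<forall>x. 0 < f x) \<and> (\<forall>x. laplacian w m f x = - l * f x)"
proof -
  fix p :: 'v
  have "\<exists>C>0. \<forall>u. supersolution u \<longrightarrow> u x \<le> C * u p \<and> u p \<le> C * u x" for x
  proof -
    obtain C where C: "C > 0" "\<And>u. supersolution u \<Longrightarrow> u x \<le> C * u p" using harnack by blast
    obtain C' where C': "C' > 0" "\<And>u. supersolution u \<Longrightarrow> u p \<le> C' * u x" using harnack by blast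
    have "u x \<le> max C C' * u p \<and> u p \<le> max C C' * u x" if u: "supersolution u" for u
    proof -
      have "0 \<le> u x" "0 \<le> u p" using u by (auto simp: supersolution_def)
      then have "C * u p \<le> max C C' * u p" "C' * u x \<le> max C C' * u x"
        by (auto intro!: mult_right_mono)
      then show ?thesis using C(2)[OF u] C'(2)[OF u] by linarith
    qed
    then show ?thesis using C(1) by (intro exI[of _ "max C C'"]) auto
  qed
  then obtain C where Cpos: "\<And>x. 0 < C x"
    and C: "\<And>x u. supersolution u \<Longrightarrow> u x \<le> C x * u p \<and> u p \<le> C x * u x" by metis
  \<comment> \<open>The lower endpoints keep the limit function strictly positive, hence the
    two-sided Harnack constants.\<close>
  define P where "P = PiE (UNIV :: 'v set) (\<lambda>x. {1 / C x..C x})"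
  define A where "A = (\<lambda>x. {f. (\<Sum>y\<in>neighbors w x. w x y * f y) = (deg w x - l * m x) * f x})"
  have cP: "compact P"
    unfolding P_def compactin_euclidean_iff[symmetric] euclidean_product_topology[symmetric]
    by (subst compactin_PiE) (simp add: compactin_euclidean_iff)
  \<comment> \<open>By local finiteness the condition at \<open>x\<close> involves finitely many
    coordinates, so it is closed in the product topology.\<close>
  have cA: "closed (A x)" for x
    unfolding A_def
    by (intro closed_Collect_eq continuous_intros continuous_on_product_coordinates)
  have fip: "P \<inter> (\<Inter>x\<in>F. A x) \<noteq> {}" if F: "finite F" for F
  proof -
    obtain a where a: "a \<notin> F" using inf F ex_new_if_finite by blast
    obtain u where u: "\<And>x. 0 \<le> u x" "0 < u a"
      and eq: "\<And>x. (deg w x - l * m x) * u x = (if x = a then 1 else 0) + (\<Sum>y\<in>neighbors w x. w x y * u y)"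
      using green_function_exists[OF r l(2), of a] by blast
    have ss: "supersolution u"
      unfolding supersolution_def
    proof (intro conjI allI u)
      fix x y
      have "w x y * u y \<le> (\<Sum>y\<in>neighbors w x. w x y * u y)"
        using sum_le_sum_neighbors[of "{y}" u x] u(1) by simp
      also have "\<dots> \<le> (deg w x - l * m x) * u x" by (simp add: eq)
      also have "\<dots> \<le> deg w x * u x"
        using u(1)[of x] l(1) measure_pos[of x] by (intro mult_right_mono) auto
      finally show "w x y * u y \<le> deg w x * u x" .
    qed
    have up: "0 < u p" using C[OF ss, of a] u(2) Cpos[of a] by (smt (verit) zero_less_mult_iff)
    define f where "f = (\<lambda>x. u x / u p)"
    have "f x \<in> {1 / C x..C x}" for x
      using C[OF ss, of x] up Cpos[of x] by (simp add: f_def field_simps)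
    then have "f \<in> P" by (auto simp: P_def PiE_def Pi_def)
    moreover have "f \<in> A x" if "x \<in> F" for x
    proof -
      have "x \<noteq> a" using that a by auto
      then show ?thesis using eq[of x] by (simp add: A_def f_def sum_divide_distrib[symmetric])
    qed
    ultimately show ?thesis by blast
  qed
  have "P \<inter> (\<Inter>x\<in>UNIV. A x) \<noteq> {}"
    by (rule compact_imp_fip_image[OF cP cA fip])
  then obtain f where "f \<in> P \<inter> (\<Inter>x\<in>UNIV. A x)" by blast
  then have f: "f \<in> P" "\<And>x. f \<in> A x" by auto
  have "0 < f x" for x
  proof -
    have "1 / C x \<le> f x" using f(1) by (auto simp: P_def PiE_def Pi_def)
    then show ?thesis using Cpos[of x] by (smt (verit) zero_less_divide_1_iff)
  qed
  moreover have "laplacian w m f x = - l * f x" for x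
  proof -
    have "m x * laplacian w m f x = m x * (- l * f x)"
      using f(2)[of x] laplacian_eq_deg[of x f] by (simp add: A_def algebra_simps)
    then show ?thesis using measure_pos[of x] by (metis less_irrefl mult_cancel_left)
  qed
  ultimately show ?thesis by blast
qed

section \<open>The curvature condition and the maximum principle\<close>

text \<open>
  The supremum of $G$ need not be attained, so the maximum principle is applied at a point where
  $G$ is within $\varepsilon$ of it.
\<close>

lemma positive_solution_eigenvalue_le:
  assumes cde: "CDE w m n (- K)" and n: "0 < n" and l: "0 < l"
    and \<phi>: "\<And>x. 0 < \<phi> x" "\<And>x. laplacian w m \<phi> x = - l * \<phi> x"
  shows "l \<le> K * n"
proof (rule ccontr)
  assume "\<not> l \<le> K * n"
  then have less: "K * n < l" by simp
  obtain D where D: "0 < D" "\<And>x. deg w x \<le> D * m x" using deg_le_measure by blast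
  define f where "f = (\<lambda>x. sqrt (\<phi> x))"
  have f: "0 < f x" "f x * f x = \<phi> x" for x
    using \<phi>(1)[of x] by (auto simp: f_def)
  define G where "G = (\<lambda>x. \<Gamma> w m f f x / \<phi> x)"
  have \<Gamma>G: "\<Gamma> w m f f x = G x * \<phi> x" for x using \<phi>(1)[of x] by (simp add: G_def)
  have \<Gamma>def: "\<Gamma> w m f f x = (laplacian w m \<phi> x - 2 * f x * laplacian w m f x) / 2" for x
    by (simp add: \<Gamma>_def f)
  have \<Delta>f: "laplacian w m f x = - (l / 2 + G x) * f x" for x
  proof -
    have "2 * f x * laplacian w m f x = 2 * f x * (- (l / 2 + G x) * f x)"
      using \<Gamma>def[of x] \<phi>(2)[of x] \<Gamma>G[of x] by (simp add: f(2)[symmetric] algebra_simps)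
    then show ?thesis using f(1)[of x] by (simp only: mult_cancel_left) simp
  qed
  have G0: "0 \<le> G x" for x
    unfolding G_def \<Gamma>_eq using measure_pos[of x] \<phi>(1)[of x]
    by (intro divide_nonneg_pos sum_nonneg mult_nonneg_nonneg[OF weight_nonneg zero_le_square]) auto
  \<comment> \<open>The supremum of \<open>G\<close> must be finite. As \<open>f\<close> is
    positive, (f y - f x)^2 is at most \<phi> y + \<phi> x, and \<Delta>\<phi> \<le> 0 does the
    rest.\<close>
  have GD: "G x \<le> D" for x
  proof -
    have "2 * m x * \<Gamma> w m f f x = (\<Sum>y\<in>neighbors w x. w x y * ((f y - f x) * (f y - f x)))"
      using measure_pos[of x] by (simp add: \<Gamma>_eq)
    also have "\<dots> \<le> (\<Sum>y\<in>neighbors w x. w x y * (\<phi> y + \<phi> x))"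
    proof (intro sum_mono mult_left_mono weight_nonneg)
      fix y
      have "0 \<le> f x * f y" using f(1)[of x] f(1)[of y] by simp
      then show "(f y - f x) * (f y - f x) \<le> \<phi> y + \<phi> x"
        by (simp add: f(2)[symmetric] algebra_simps)
    qed
    also have "\<dots> = m x * laplacian w m \<phi> x + 2 * (deg w x * \<phi> x)"
      by (simp add: laplacian_eq_deg distrib_left sum.distrib deg_def sum_distrib_right)
    also have "\<dots> \<le> 2 * (D * m x * \<phi> x)"
    proof -
      have "m x * laplacian w m \<phi> x \<le> 0"
        using measure_pos[of x] \<phi>[of x] l by (simp add: mult_nonneg_nonneg less_imp_le)
      moreover have "deg w x * \<phi> x \<le> D * m x * \<phi> x" using D(2) \<phi>(1)[of x] by (intro mult_right_mono) auto
      ultimately show ?thesis by linarith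
    qed
    finally have "(2 * m x * \<phi> x) * G x \<le> (2 * m x * \<phi> x) * D" by (simp add: \<Gamma>G algebra_simps)
    then show ?thesis using measure_pos[of x] \<phi>(1)[of x] by simp
  qed
  have bdd: "bdd_above (range G)" using GD by (auto simp: bdd_above_def)
  define s where "s = Sup (range G)"
  have Gs: "G x \<le> s" for x unfolding s_def by (rule cSup_upper[OF _ bdd]) simp
  \<comment> \<open>Chosen so that the error from missing the supremum is l^2/8 after multiplication
    by \<open>n\<close>, half of the l^2/4 in the expansion of (l/2 + G)^2.\<close>
  define \<epsilon> where "\<epsilon> = l\<^sup>2 / (4 * n * D)"
  have \<epsilon>: "0 < \<epsilon>" using l n D(1) by (simp add: \<epsilon>_def)
  then have "\<exists>y\<in>range G. s - \<epsilon> < y"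
    using less_cSup_iff[OF _ bdd, of "s - \<epsilon>"] by (auto simp: s_def)
  then obtain x where x: "s - \<epsilon> < G x" by blast
  define F where "F = (f x)\<^sup>2"
  have F: "F = \<phi> x" "0 < F" using f(2)[of x] \<phi>(1)[of x] by (auto simp: F_def power2_eq_square)
  have "laplacian w m f x < 0"
    unfolding \<Delta>f using G0[of x] l f(1)[of x] by (simp add: mult_neg_pos)
  then have curv: "\<Gamma>2 w m f f x - \<Gamma> w m f (\<lambda>y. \<Gamma> w m f f y / f y) x
      \<ge> (1 / n) * (laplacian w m f x)\<^sup>2 + - K * \<Gamma> w m f f x"
    using cde f(1) unfolding CDE_def by blast
  have bochner: "\<Gamma>2 w m f f x - \<Gamma> w m f (\<lambda>y. \<Gamma> w m f f y / f y) x
      = laplacian w m (\<Gamma> w m f f) x / 2 + l / 2 * (G x * F)"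
  proof -
    have "(\<lambda>y. laplacian w m f y + \<Gamma> w m f f y / f y) = (\<lambda>y. (- l / 2) * f y)"
    proof
      fix y
      have "\<Gamma> w m f f y / f y = G y * f y"
        using f(1)[of y] by (simp add: \<Gamma>G f(2)[symmetric])
      then show "laplacian w m f y + \<Gamma> w m f f y / f y = (- l / 2) * f y"
        by (simp add: \<Delta>f algebra_simps)
    qed
    then have "\<Gamma> w m f (laplacian w m f) x + \<Gamma> w m f (\<lambda>y. \<Gamma> w m f f y / f y) x = (- l / 2) * (G x * F)"
      unfolding \<Gamma>_add_right[symmetric] by (simp only: \<Gamma>_scale_right \<Gamma>G F)
    moreover have "\<Gamma>2 w m f f x = laplacian w m (\<Gamma> w m f f) x / 2 - \<Gamma> w m f (laplacian w m f) x"
      by (simp add: \<Gamma>2_def \<Gamma>_commute[of w m "laplacian w m f" f])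
    ultimately show ?thesis by simp
  qed
  \<comment> \<open>At the neighbours \<open>G\<close> is replaced by its supremum \<open>s\<close>.
    The centre carries \<open>G x\<close> instead, and this mismatch costs at most (s - G x) D
    F.\<close>
  have \<Delta>\<Gamma>: "laplacian w m (\<Gamma> w m f f) x \<le> - l * s * F + (s - G x) * D * F"
  proof -
    have "m x * laplacian w m (\<Gamma> w m f f) x
        = (\<Sum>y\<in>neighbors w x. w x y * (G y * \<phi> y)) - deg w x * (G x * \<phi> x)"
      by (simp add: laplacian_eq_deg \<Gamma>G)
    also have "\<dots> \<le> (\<Sum>y\<in>neighbors w x. w x y * (s * \<phi> y)) - deg w x * (G x * \<phi> x)"
      by (intro diff_right_mono sum_mono mult_left_mono mult_right_mono Gs weight_nonneg)
        (simp add: \<phi>(1) less_imp_le)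
    also have "\<dots> = s * (m x * laplacian w m \<phi> x) + (s - G x) * deg w x * \<phi> x"
      by (simp add: laplacian_eq_deg sum_distrib_left algebra_simps)
    also have "\<dots> \<le> s * (m x * laplacian w m \<phi> x) + (s - G x) * (D * m x) * \<phi> x"
      by (intro add_left_mono mult_right_mono mult_left_mono D) (use Gs[of x] \<phi>(1)[of x] in auto)
    also have "\<dots> = m x * (- l * s * F + (s - G x) * D * F)"
      by (simp add: \<phi>(2) F algebra_simps)
    finally show ?thesis using measure_pos[of x] by simp
  qed
  have "(laplacian w m f x)\<^sup>2 = (l / 2 + G x)\<^sup>2 * F"
    by (simp only: \<Delta>f power_mult_distrib power2_minus F_def)
  moreover have "\<Gamma> w m f f x = G x * F" by (simp add: \<Gamma>G F(1))
  ultimately have "(1 / n) * ((l / 2 + G x)\<^sup>2 * F) + - K * (G x * F)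
      \<le> laplacian w m (\<Gamma> w m f f) x / 2 + l / 2 * (G x * F)"
    using curv unfolding bochner by (simp only:)
  also have "\<dots> \<le> (- l * s * F + (s - G x) * D * F) / 2 + l / 2 * (G x * F)"
    using \<Delta>\<Gamma> by (intro add_right_mono divide_right_mono) auto
  finally have "((l / 2 + G x)\<^sup>2 / n - K * G x) * F \<le> ((s - G x) * D / 2 - l / 2 * (s - G x)) * F"
    by (simp add: field_simps)
  then have main: "(l / 2 + G x)\<^sup>2 / n - K * G x \<le> (s - G x) * D / 2 - l / 2 * (s - G x)"
    using F(2) by simp
  have "0 \<le> l / 2 * (s - G x)" using l Gs[of x] by simp
  moreover have "(s - G x) * D \<le> \<epsilon> * D" using x D(1) by (intro mult_right_mono) auto
  ultimately have "(l / 2 + G x)\<^sup>2 / n - K * G x \<le> \<epsilon> * D / 2" using main by linarith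
  then have "((l / 2 + G x)\<^sup>2 / n - K * G x) * n \<le> \<epsilon> * D / 2 * n"
    using n by (intro mult_right_mono) auto
  also have "\<epsilon> * D / 2 * n = l\<^sup>2 / 8" using n D(1) by (simp add: \<epsilon>_def)
  finally have "((l / 2 + G x)\<^sup>2 / n - K * G x) * n \<le> l\<^sup>2 / 8" .
  moreover have "((l / 2 + G x)\<^sup>2 / n - K * G x) * n = (l / 2 + G x)\<^sup>2 - K * n * G x"
    using n by (simp add: left_diff_distrib)
  moreover have "K * n * G x \<le> l * G x" using less G0[of x] by (intro mult_right_mono) auto
  moreover have "(l / 2 + G x)\<^sup>2 = l\<^sup>2 / 4 + l * G x + (G x)\<^sup>2"
    by (simp add: power2_eq_square algebra_simps)
  moreover have "0 \<le> (G x)\<^sup>2" "0 < l\<^sup>2" using l by auto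
  ultimately show False by linarith
qed

text \<open>On a finite graph the constant function has energy zero, which forces r \<le> 0. On an
  infinite graph take \<open>l\<close> strictly between \<open>K * n\<close> and \<open>r\<close>:
  below \<open>r\<close> a positive solution exists, above \<open>K * n\<close> it is
  excluded.\<close>

lemma coercive_le:
  assumes cde: "CDE w m n (- K)" and K: "0 \<le> K" and n: "0 < n" and r: "coercive r"
  shows "r \<le> K * n"
proof (cases "finite (UNIV :: 'v set)")
  case True
  have "dform UNIV (\<lambda>_. 1) (\<lambda>_. 1) = 0"
    using sum_laplacian_eq_dform[OF True, of "\<lambda>_. 1" "\<lambda>_. 1"] by (simp add: laplacian_def)
  moreover have "r * mass UNIV (\<lambda>_. 1) \<le> dform UNIV (\<lambda>_. 1) (\<lambda>_. 1)"
    using r True unfolding coercive_def by blast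
  moreover have "0 < mass UNIV (\<lambda>_. 1)"
    unfolding mass_def using True measure_pos by (intro sum_pos) auto
  ultimately have "r \<le> 0" by (simp add: mult_le_0_iff)
  then show ?thesis using K n by (smt (verit) mult_nonneg_nonneg)
next
  case False
  show ?thesis
  proof (rule ccontr)
    assume "\<not> r \<le> K * n"
    then obtain l where l: "K * n < l" "l < r" using dense[of "K * n" r] by auto
    have l0: "0 < l" using l(1) K n mult_nonneg_nonneg[of K n] by linarith
    obtain \<phi> where "\<And>x. 0 < \<phi> x" "\<And>x. laplacian w m \<phi> x = - l * \<phi> x"
      using positive_solution_exists[OF r _ l(2) False] l0 by auto
    from positive_solution_eigenvalue_le[OF cde n l0 this] l(1) show False by simp
  qed
qed

section \<open>The Laplacian as a bounded operator on complex l2\<close>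

definition l2_sq :: "('v \<Rightarrow> complex) \<Rightarrow> real" where
  "l2_sq f = (\<Sum>\<^sub>\<infinity>x. m x * (cmod (f x))\<^sup>2)"

lemma l2_norm_eq: "l2_norm m f = sqrt (l2_sq f)"
  by (simp add: l2_norm_def l2_sq_def)

lemma l2_summand_nonneg: "0 \<le> m x * (cmod (f x))\<^sup>2"
  using measure_pos[of x] by simp

lemma l2_sq_nonneg: "0 \<le> l2_sq f"
  unfolding l2_sq_def by (intro infsum_nonneg l2_summand_nonneg)

text \<open>The terms are nonnegative, so bounded finite partial sums give summability and the bound
  on the total at once. The l2 estimates below therefore work with finite sums.\<close>

lemma l2I:
  assumes "\<And>F. finite F \<Longrightarrow> (\<Sum>x\<in>F. m x * (cmod (f x))\<^sup>2) \<le> B"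
  shows "f \<in> l2 m" "l2_sq f \<le> B"
proof -
  show f: "f \<in> l2 m"
    unfolding l2_def mem_Collect_eq
    by (rule nonneg_bdd_above_summable_on[OF l2_summand_nonneg]) (use assms in \<open>auto simp: bdd_above_def\<close>)
  show "l2_sq f \<le> B"
    unfolding l2_sq_def by (rule infsum_le_finite_sums) (use f assms in \<open>auto simp: l2_def\<close>)
qed

lemma sum_le_l2_sq:
  assumes "f \<in> l2 m" "finite F"
  shows "(\<Sum>x\<in>F. m x * (cmod (f x))\<^sup>2) \<le> l2_sq f"
  unfolding l2_sq_def
  by (rule finite_sum_le_infsum) (use assms l2_summand_nonneg in \<open>auto simp: l2_def\<close>)

lemma l2_finite_support:
  fixes u :: "'v \<Rightarrow> real"
  assumes "finite S" "\<And>x. x \<notin> S \<Longrightarrow> u x = 0"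
  shows "(\<lambda>x. complex_of_real (u x)) \<in> l2 m" "l2_sq (\<lambda>x. complex_of_real (u x)) = mass S u"
proof -
  have "(\<lambda>x. m x * (cmod (complex_of_real (u x)))\<^sup>2) summable_on UNIV
      \<longleftrightarrow> (\<lambda>x. m x * (u x)\<^sup>2) summable_on S"
    by (rule summable_on_cong_neutral) (use assms in auto)
  then show "(\<lambda>x. complex_of_real (u x)) \<in> l2 m"
    using summable_on_finite[OF assms(1)] by (simp add: l2_def)
  have "l2_sq (\<lambda>x. complex_of_real (u x)) = (\<Sum>\<^sub>\<infinity>x\<in>S. m x * (u x)\<^sup>2)"
    unfolding l2_sq_def by (rule infsum_cong_neutral) (use assms in auto)
  then show "l2_sq (\<lambda>x. complex_of_real (u x)) = mass S u"
    by (simp add: mass_def assms(1))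
qed

lemma power2_add_le: "(a + b)\<^sup>2 \<le> 2 * a\<^sup>2 + 2 * b\<^sup>2" for a b :: real
  using sum_squares_bound[of a b] by (simp add: power2_sum)

text \<open>The inequality (a + b)^2 \<le> 2a^2 + 2b^2 stands in for Minkowski; in the resolvent
  estimates the size of the shift \<open>s\<close> absorbs the lost constants.\<close>

lemma l2_triangle_sum_le:
  assumes c: "\<And>x. cmod (h x) \<le> cmod (f x) + cmod (g x)"
    and f: "\<And>F. finite F \<Longrightarrow> (\<Sum>x\<in>F. m x * (cmod (f x))\<^sup>2) \<le> A"
    and g: "\<And>F. finite F \<Longrightarrow> (\<Sum>x\<in>F. m x * (cmod (g x))\<^sup>2) \<le> B"
    and F: "finite F"
  shows "(\<Sum>x\<in>F. m x * (cmod (h x))\<^sup>2) \<le> 2 * A + 2 * B"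
proof -
  have "(\<Sum>x\<in>F. m x * (cmod (h x))\<^sup>2)
      \<le> (\<Sum>x\<in>F. 2 * (m x * (cmod (f x))\<^sup>2) + 2 * (m x * (cmod (g x))\<^sup>2))"
  proof (rule sum_mono)
    fix x
    have "(cmod (h x))\<^sup>2 \<le> (cmod (f x) + cmod (g x))\<^sup>2" by (intro power_mono c) simp
    also have "\<dots> \<le> 2 * (cmod (f x))\<^sup>2 + 2 * (cmod (g x))\<^sup>2" by (rule power2_add_le)
    finally have "m x * (cmod (h x))\<^sup>2 \<le> m x * (2 * (cmod (f x))\<^sup>2 + 2 * (cmod (g x))\<^sup>2)"
      using measure_pos[of x] by simp
    then show "m x * (cmod (h x))\<^sup>2 \<le> 2 * (m x * (cmod (f x))\<^sup>2) + 2 * (m x * (cmod (g x))\<^sup>2)"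
      by (simp add: algebra_simps)
  qed
  also have "\<dots> = 2 * (\<Sum>x\<in>F. m x * (cmod (f x))\<^sup>2) + 2 * (\<Sum>x\<in>F. m x * (cmod (g x))\<^sup>2)"
    by (simp add: sum.distrib sum_distrib_left)
  also have "\<dots> \<le> 2 * A + 2 * B" using f[OF F] g[OF F] by simp
  finally show ?thesis .
qed

text \<open>Cauchy-Schwarz with each weight split into two square roots; the resulting factor
  \<open>deg w x\<close> is later traded for \<open>D * m x\<close>.\<close>

lemma cmod_laplacian_sq_le:
  "m x * (m x * (cmod (laplacian w m f x))\<^sup>2)
    \<le> 2 * deg w x * ((\<Sum>y\<in>neighbors w x. w x y * (cmod (f y))\<^sup>2) + deg w x * (cmod (f x))\<^sup>2)"
proof -
  let ?N = "neighbors w x"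
  have "m x * cmod (laplacian w m f x) = cmod (\<Sum>y\<in>?N. w x y *\<^sub>R (f y - f x))"
    using measure_pos[of x] by (simp add: laplacian_def norm_divide)
  also have "\<dots> \<le> (\<Sum>y\<in>?N. sqrt (w x y) * (sqrt (w x y) * cmod (f y - f x)))"
    by (rule order_trans[OF norm_sum])
      (simp add: weight_nonneg mult.assoc[symmetric] real_sqrt_mult_self)
  finally have "(m x * cmod (laplacian w m f x))\<^sup>2
      \<le> (\<Sum>y\<in>?N. sqrt (w x y) * (sqrt (w x y) * cmod (f y - f x)))\<^sup>2"
    using measure_pos[of x] by (intro power_mono) auto
  also have "\<dots> \<le> (\<Sum>y\<in>?N. (sqrt (w x y))\<^sup>2) * (\<Sum>y\<in>?N. (sqrt (w x y) * cmod (f y - f x))\<^sup>2)"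
    by (rule Cauchy_Schwarz_ineq_sum)
  also have "\<dots> = deg w x * (\<Sum>y\<in>?N. w x y * (cmod (f y - f x))\<^sup>2)"
    by (simp add: power_mult_distrib weight_nonneg deg_def)
  also have "\<dots> \<le> deg w x * (\<Sum>y\<in>?N. w x y * (2 * (cmod (f y))\<^sup>2 + 2 * (cmod (f x))\<^sup>2))"
  proof (intro mult_left_mono sum_mono weight_nonneg deg_nonneg)
    fix y
    have "(cmod (f y - f x))\<^sup>2 \<le> (cmod (f y) + cmod (f x))\<^sup>2"
      by (intro power_mono norm_triangle_ineq4) simp
    also have "\<dots> \<le> 2 * (cmod (f y))\<^sup>2 + 2 * (cmod (f x))\<^sup>2" by (rule power2_add_le)
    finally show "(cmod (f y - f x))\<^sup>2 \<le> 2 * (cmod (f y))\<^sup>2 + 2 * (cmod (f x))\<^sup>2" .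
  qed
  also have "(\<Sum>y\<in>?N. w x y * (2 * (cmod (f y))\<^sup>2 + 2 * (cmod (f x))\<^sup>2))
      = 2 * ((\<Sum>y\<in>?N. w x y * (cmod (f y))\<^sup>2) + deg w x * (cmod (f x))\<^sup>2)"
    by (simp add: deg_def sum_distrib_left sum_distrib_right sum.distrib distrib_left mult_ac)
  finally show ?thesis by (simp add: power_mult_distrib power2_eq_square mult_ac)
qed

text \<open>A Schur test: after exchanging the sums, symmetry of \<open>w\<close> bounds the column
  sums by degrees. The constant amounts to operator norm at most 2D.\<close>

lemma laplacian_l2_sum_le:
  assumes D: "0 < D" "\<And>x. deg w x \<le> D * m x" and f: "f \<in> l2 m" and F: "finite F"
  shows "(\<Sum>x\<in>F. m x * (cmod (laplacian w m f x))\<^sup>2) \<le> 4 * D\<^sup>2 * l2_sq f"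
proof -
  define S where "S = (\<Union>x\<in>F. neighbors w x)"
  have S: "finite S" using F locally_finite by (simp add: S_def)
  have le: "m x * (cmod (laplacian w m f x))\<^sup>2
      \<le> 2 * D * ((\<Sum>y\<in>neighbors w x. w x y * (cmod (f y))\<^sup>2) + deg w x * (cmod (f x))\<^sup>2)" for x
  proof -
    let ?E = "(\<Sum>y\<in>neighbors w x. w x y * (cmod (f y))\<^sup>2) + deg w x * (cmod (f x))\<^sup>2"
    have "0 \<le> ?E"
      by (intro add_nonneg_nonneg sum_nonneg mult_nonneg_nonneg weight_nonneg deg_nonneg) auto
    then have "2 * deg w x * ?E \<le> 2 * (D * m x) * ?E"
      using D(2)[of x] by (intro mult_right_mono mult_left_mono) auto
    with cmod_laplacian_sq_le[of x f]
    have "m x * (m x * (cmod (laplacian w m f x))\<^sup>2) \<le> m x * (2 * D * ?E)"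
      by (simp add: mult_ac)
    then show ?thesis using measure_pos[of x] by simp
  qed
  have degle: "(\<Sum>x\<in>T. deg w x * (cmod (f x))\<^sup>2) \<le> D * l2_sq f" if "finite T" for T
  proof -
    have "(\<Sum>x\<in>T. deg w x * (cmod (f x))\<^sup>2) \<le> D * (\<Sum>x\<in>T. m x * (cmod (f x))\<^sup>2)"
      unfolding sum_distrib_left mult.assoc[symmetric] by (intro sum_mono mult_right_mono D) auto
    also have "\<dots> \<le> D * l2_sq f" using sum_le_l2_sq[OF f that] D(1) by simp
    finally show ?thesis .
  qed
  have "(\<Sum>x\<in>F. \<Sum>y\<in>neighbors w x. w x y * (cmod (f y))\<^sup>2) \<le> (\<Sum>x\<in>F. \<Sum>y\<in>S. w x y * (cmod (f y))\<^sup>2)"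
    by (intro sum_mono sum_mono2 S) (auto simp: S_def weight_nonneg)
  also have "\<dots> = (\<Sum>y\<in>S. (\<Sum>x\<in>F. w y x) * (cmod (f y))\<^sup>2)"
    by (subst sum.swap) (simp add: sum_distrib_right weight_sym)
  also have "\<dots> \<le> (\<Sum>y\<in>S. deg w y * (cmod (f y))\<^sup>2)"
    by (intro sum_mono mult_right_mono sum_weight_le_deg F) auto
  also have "\<dots> \<le> D * l2_sq f" by (rule degle[OF S])
  finally have 1: "(\<Sum>x\<in>F. \<Sum>y\<in>neighbors w x. w x y * (cmod (f y))\<^sup>2) \<le> D * l2_sq f" .
  have "(\<Sum>x\<in>F. m x * (cmod (laplacian w m f x))\<^sup>2)
      \<le> (\<Sum>x\<in>F. 2 * D * ((\<Sum>y\<in>neighbors w x. w x y * (cmod (f y))\<^sup>2) + deg w x * (cmod (f x))\<^sup>2))"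
    by (rule sum_mono[OF le])
  also have "\<dots> = 2 * D * ((\<Sum>x\<in>F. \<Sum>y\<in>neighbors w x. w x y * (cmod (f y))\<^sup>2)
      + (\<Sum>x\<in>F. deg w x * (cmod (f x))\<^sup>2))"
    by (simp only: sum_distrib_left sum.distrib distrib_left)
  also have "\<dots> \<le> 2 * D * (D * l2_sq f + D * l2_sq f)"
    using D(1) by (intro mult_left_mono add_mono 1 degle F) auto
  finally show ?thesis by (simp add: power2_eq_square)
qed

lemma laplacian_diff:
  fixes f g :: "'v \<Rightarrow> complex"
  shows "laplacian w m (\<lambda>x. f x - g x) x = laplacian w m f x - laplacian w m g x"
proof -
  have "(\<Sum>y\<in>neighbors w x. w x y *\<^sub>R (f y - g y - (f x - g x)))
      = (\<Sum>y\<in>neighbors w x. w x y *\<^sub>R (f y - f x)) - (\<Sum>y\<in>neighbors w x. w x y *\<^sub>R (g y - g x))"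
    unfolding sum_subtractf[symmetric] by (intro sum.cong) (auto simp: algebra_simps)
  then show ?thesis by (simp add: laplacian_def scaleR_diff_right)
qed

lemma l2_scale_sum:
  assumes "0 < s"
  shows "(\<Sum>x\<in>F. m x * (cmod (f x / complex_of_real s))\<^sup>2) = (\<Sum>x\<in>F. m x * (cmod (f x))\<^sup>2) / s\<^sup>2"
  by (simp add: norm_divide power_divide sum_divide_distrib)

text \<open>With s \<ge> 4D the contribution 8 D^2 \<open>l2_sq f\<close> of \<Delta>f is at most
  half of s^2 \<open>l2_sq f\<close> and is absorbed into the left side.\<close>

lemma shifted_laplacian_bound:
  assumes D: "0 < D" "\<And>x. deg w x \<le> D * m x" and s: "4 * D \<le> s" and f: "f \<in> l2 m"
  defines "h \<equiv> \<lambda>x. - laplacian w m f x - complex_of_real (- s) * f x"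
  shows "h \<in> l2 m" "s\<^sup>2 * l2_sq f \<le> 4 * l2_sq h"
proof -
  have s0: "0 < s" using D s by simp
  have "(4 * D)\<^sup>2 \<le> s\<^sup>2" using D s by (intro power_mono) auto
  then have D2: "16 * D\<^sup>2 \<le> s\<^sup>2" by (simp add: power_mult_distrib)
  have sf: "(\<Sum>x\<in>F. m x * (cmod (complex_of_real s * f x))\<^sup>2) = s\<^sup>2 * (\<Sum>x\<in>F. m x * (cmod (f x))\<^sup>2)" for F
    by (simp add: norm_mult power_mult_distrib sum_distrib_left mult_ac)
  have "(\<Sum>x\<in>F. m x * (cmod (h x))\<^sup>2) \<le> 2 * (4 * D\<^sup>2 * l2_sq f) + 2 * (s\<^sup>2 * l2_sq f)"
    if "finite F" for F
  proof (rule l2_triangle_sum_le[OF _ laplacian_l2_sum_le[OF D f] _ that])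
    show "cmod (h x) \<le> cmod (laplacian w m f x) + cmod (complex_of_real s * f x)" for x
      using norm_triangle_ineq4[of "complex_of_real s * f x" "laplacian w m f x"] by (simp add: h_def)
    show "(\<Sum>x\<in>F. m x * (cmod (complex_of_real s * f x))\<^sup>2) \<le> s\<^sup>2 * l2_sq f" if "finite F" for F
      unfolding sf using sum_le_l2_sq[OF f that] by (intro mult_left_mono) auto
  qed
  then show h: "h \<in> l2 m" by (rule l2I)
  have "s\<^sup>2 * (\<Sum>x\<in>F. m x * (cmod (f x))\<^sup>2) \<le> 2 * l2_sq h + 2 * (4 * D\<^sup>2 * l2_sq f)"
    if "finite F" for F
    unfolding sf[symmetric]
  proof (rule l2_triangle_sum_le[OF _ sum_le_l2_sq[OF h] laplacian_l2_sum_le[OF D f] that])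
    show "cmod (complex_of_real s * f x) \<le> cmod (h x) + cmod (laplacian w m f x)" for x
      using norm_triangle_ineq[of "h x" "laplacian w m f x"] by (simp add: h_def)
  qed
  then have "(\<Sum>x\<in>F. m x * (cmod (f x))\<^sup>2) \<le> (2 * l2_sq h + 2 * (4 * D\<^sup>2 * l2_sq f)) / s\<^sup>2"
    if "finite F" for F
    using that s0 by (simp add: pos_le_divide_eq mult.commute)
  then have "l2_sq f \<le> (2 * l2_sq h + 2 * (4 * D\<^sup>2 * l2_sq f)) / s\<^sup>2" by (rule l2I(2))
  then have "s\<^sup>2 * l2_sq f \<le> 2 * l2_sq h + 8 * D\<^sup>2 * l2_sq f"
    using s0 by (simp add: pos_le_divide_eq mult.commute)
  moreover have "16 * D\<^sup>2 * l2_sq f \<le> s\<^sup>2 * l2_sq f"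
    by (rule mult_right_mono[OF D2 l2_sq_nonneg])
  ultimately show "s\<^sup>2 * l2_sq f \<le> 4 * l2_sq h" by linarith
qed

text \<open>Picard iteration for $sf = g + \Delta f$, with pointwise limits instead of completeness of $\ell^2$.\<close>

lemma shifted_laplacian_surj:
  assumes D: "0 < D" "\<And>x. deg w x \<le> D * m x" and s: "4 * D \<le> s" and g: "g \<in> l2 m"
  shows "\<exists>f\<in>l2 m. \<forall>x. - laplacian w m f x - complex_of_real (- s) * f x = g x"
proof -
  have s0: "0 < s" using D s by simp
  have "(4 * D)\<^sup>2 \<le> s\<^sup>2" using D s by (intro power_mono) auto
  then have D2: "16 * D\<^sup>2 \<le> s\<^sup>2" by (simp add: power_mult_distrib)
  define T where "T = (\<lambda>f x. (g x + laplacian w m f x) / complex_of_real s)"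
  define U where "U = (\<lambda>k. (T ^^ k) (\<lambda>_. 0))"
  have U0: "U 0 = (\<lambda>_. 0)" by (simp add: U_def)
  have USuc: "U (Suc k) x = (g x + laplacian w m (U k) x) / complex_of_real s" for k x
    by (simp add: U_def T_def)
  \<comment> \<open>The bound that reproduces itself: 2 \<open>l2_sq g\<close> + 8 D^2 B is at most
    2 \<open>l2_sq g\<close> + s^2 B / 2 = 4 \<open>l2_sq g\<close> = s^2 B.\<close>
  define B where "B = 4 * l2_sq g / s\<^sup>2"
  have UB: "U k \<in> l2 m \<and> l2_sq (U k) \<le> B" for k
  proof (induction k)
    case 0
    have "(\<Sum>x\<in>F. m x * (cmod (U 0 x))\<^sup>2) \<le> B" for F
      by (simp add: U0 B_def l2_sq_nonneg)
    then show ?case using l2I by blast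
  next
    case (Suc k)
    have "(\<Sum>x\<in>F. m x * (cmod (U (Suc k) x))\<^sup>2) \<le> B" if "finite F" for F
    proof -
      have "(\<Sum>x\<in>F. m x * (cmod (g x + laplacian w m (U k) x))\<^sup>2)
          \<le> 2 * l2_sq g + 2 * (4 * D\<^sup>2 * l2_sq (U k))"
        using Suc
        by (intro l2_triangle_sum_le[OF norm_triangle_ineq sum_le_l2_sq[OF g] laplacian_l2_sum_le[OF D] that]) auto
      also have "\<dots> \<le> 2 * l2_sq g + 8 * D\<^sup>2 * B"
        using Suc D(1) by simp
      also have "8 * D\<^sup>2 * B \<le> s\<^sup>2 / 2 * B"
        using D2 l2_sq_nonneg[of g] by (intro mult_right_mono) (auto simp: B_def)
      also have "s\<^sup>2 / 2 * B = 2 * l2_sq g" using s0 by (simp add: B_def)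
      finally have "(\<Sum>x\<in>F. m x * (cmod (g x + laplacian w m (U k) x))\<^sup>2) \<le> 4 * l2_sq g" by simp
      then show ?thesis
        unfolding USuc l2_scale_sum[OF s0] B_def by (simp add: divide_right_mono)
    qed
    then show ?case using l2I by blast
  qed
  \<comment> \<open>Consecutive differences obey the homogeneous recursion, so their squared norms
    shrink by 4D^2/s^2 \<le> 1/4; at each vertex they are dominated by a geometric series of ratio
    1/2.\<close>
  define d where "d = (\<lambda>k x. U (Suc k) x - U k x)"
  define E where "E = l2_sq (d 0)"
  have dB: "d k \<in> l2 m \<and> l2_sq (d k) \<le> (1 / 4) ^ k * E" for k
  proof (induction k)
    case 0
    have "d 0 = U 1" by (simp add: d_def U0)
    then show ?case using UB[of 1] by (simp add: E_def)
  next
    case (Suc k)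
    have dSuc: "d (Suc k) x = laplacian w m (d k) x / complex_of_real s" for x
      by (simp add: d_def laplacian_diff USuc[of _ x] diff_divide_distrib[symmetric])
    have "(\<Sum>x\<in>F. m x * (cmod (d (Suc k) x))\<^sup>2) \<le> (1 / 4) ^ Suc k * E" if "finite F" for F
    proof -
      have "(\<Sum>x\<in>F. m x * (cmod (laplacian w m (d k) x))\<^sup>2) \<le> 4 * D\<^sup>2 * l2_sq (d k)"
        using Suc by (intro laplacian_l2_sum_le[OF D _ that]) auto
      also have "\<dots> \<le> s\<^sup>2 / 4 * l2_sq (d k)"
        using D2 by (intro mult_right_mono l2_sq_nonneg) auto
      also have "\<dots> \<le> s\<^sup>2 / 4 * ((1 / 4) ^ k * E)" using Suc by (intro mult_left_mono) auto
      finally show ?thesis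
        unfolding dSuc l2_scale_sum[OF s0] using s0 by (simp add: field_simps)
    qed
    then show ?case using l2I by blast
  qed
  have "convergent (\<lambda>k. U k x)" for x
  proof -
    have "cmod (d k x) \<le> sqrt (E / m x) * (1 / 2) ^ k" for k
    proof -
      have "m x * (cmod (d k x))\<^sup>2 \<le> (1 / 4) ^ k * E"
        using sum_le_l2_sq[of "d k" "{x}"] dB[of k] by simp
      then have "(cmod (d k x))\<^sup>2 \<le> E / m x * (1 / 4) ^ k"
        using measure_pos[of x] by (simp add: field_simps)
      also have "\<dots> = (sqrt (E / m x) * (1 / 2) ^ k)\<^sup>2"
        using measure_pos[of x] l2_sq_nonneg[of "d 0"]
        by (simp add: E_def power_mult_distrib power_mult[symmetric] mult.commute[of k 2] power_mult power_divide)
      finally show ?thesis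
        using measure_pos[of x] l2_sq_nonneg[of "d 0"]
        by (intro power2_le_imp_le[of "cmod (d k x)"]) (auto simp: E_def)
    qed
    then have "summable (\<lambda>k. d k x)"
      by (intro summable_comparison_test'[OF summable_mult[OF summable_geometric]]) auto
    moreover have "(\<Sum>j<k. d j x) = U k x" for k
      using sum_lessThan_telescope[of "\<lambda>j. U j x" k] by (simp add: d_def U0)
    ultimately show ?thesis by (simp add: summable_iff_convergent)
  qed
  then obtain f where lim: "\<And>x. (\<lambda>k. U k x) \<longlonglongrightarrow> f x"
    unfolding convergent_def by metis
  have "(\<Sum>x\<in>F. m x * (cmod (f x))\<^sup>2) \<le> B" if "finite F" for F
  proof (rule LIMSEQ_le_const2)
    show "(\<lambda>k. \<Sum>x\<in>F. m x * (cmod (U k x))\<^sup>2) \<longlonglongrightarrow> (\<Sum>x\<in>F. m x * (cmod (f x))\<^sup>2)"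
      by (intro tendsto_intros lim)
    have "(\<Sum>x\<in>F. m x * (cmod (U k x))\<^sup>2) \<le> B" for k
      using sum_le_l2_sq[of "U k" F] UB[of k] that by simp
    then show "\<exists>N. \<forall>k\<ge>N. (\<Sum>x\<in>F. m x * (cmod (U k x))\<^sup>2) \<le> B" by blast
  qed
  then have "f \<in> l2 m" by (rule l2I)
  moreover have "- laplacian w m f x - complex_of_real (- s) * f x = g x" for x
  proof -
    have "f x = (g x + laplacian w m f x) / complex_of_real s"
    proof (rule LIMSEQ_unique)
      show "(\<lambda>k. U (Suc k) x) \<longlonglongrightarrow> f x" by (rule LIMSEQ_Suc[OF lim])
      show "(\<lambda>k. U (Suc k) x) \<longlonglongrightarrow> (g x + laplacian w m f x) / complex_of_real s"
        unfolding USuc laplacian_def by (intro tendsto_intros lim) (use s0 in simp)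
    qed
    then have "complex_of_real s * f x = g x + laplacian w m f x"
      using s0 by (simp add: field_simps)
    then show ?thesis by simp
  qed
  ultimately show ?thesis by blast
qed

text \<open>\<open>Inf\<close> of a set of reals carries no information unless the set is bounded
  below; this supplies the crude lower bound -4D for the real spectral values.\<close>

lemma resolvent_far_left:
  assumes D: "0 < D" "\<And>x. deg w x \<le> D * m x" and s: "4 * D \<le> s"
  shows "complex_of_real (- s) \<in> l2_resolvent_set m (\<lambda>f x. - laplacian w m f x)"
proof -
  let ?R = "\<lambda>f x. - laplacian w m f x - complex_of_real (- s) * f x"
  note bound = shifted_laplacian_bound[OF D s]
  have s0: "0 < s" using D s by simp
  have "inj_on ?R (l2 m)"
  proof (rule inj_onI)
    fix f g assume f: "f \<in> l2 m" and g: "g \<in> l2 m" and eq: "?R f = ?R g"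
    define e where "e = (\<lambda>x. f x - g x)"
    have "(\<Sum>x\<in>F. m x * (cmod (e x))\<^sup>2) \<le> 2 * l2_sq f + 2 * l2_sq g" if "finite F" for F
      unfolding e_def
      by (rule l2_triangle_sum_le[OF norm_triangle_ineq4 sum_le_l2_sq[OF f] sum_le_l2_sq[OF g] that])
    then have e: "e \<in> l2 m" by (rule l2I)
    have "?R e = (\<lambda>x. ?R f x - ?R g x)"
      by (rule ext) (simp add: e_def laplacian_diff algebra_simps)
    also have "\<dots> = (\<lambda>x. 0)" using fun_cong[OF eq] by auto
    finally have "?R e = (\<lambda>x. 0)" .
    then have "s\<^sup>2 * l2_sq e \<le> 0"
      using bound(2)[OF e] by (simp add: l2_sq_def)
    then have "l2_sq e \<le> 0" using s0 by (simp add: mult_le_0_iff)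
    then have le: "m x * (cmod (e x))\<^sup>2 \<le> 0" for x
      using sum_le_l2_sq[OF e, of "{x}"] by simp
    have "e x = 0" for x
    proof (rule ccontr)
      assume "e x \<noteq> 0"
      then have "0 < m x * (cmod (e x))\<^sup>2" using measure_pos[of x] by simp
      with le[of x] show False by simp
    qed
    then show "f = g" by (auto simp: e_def)
  qed
  moreover have "?R ` l2 m = l2 m"
  proof
    show "?R ` l2 m \<subseteq> l2 m" using bound(1) by auto
    show "l2 m \<subseteq> ?R ` l2 m"
    proof
      fix g :: "'v \<Rightarrow> complex" assume "g \<in> l2 m"
      then obtain f where "f \<in> l2 m" "\<And>x. ?R f x = g x" using shifted_laplacian_surj[OF D s] by blast
      then show "g \<in> ?R ` l2 m" by (intro image_eqI[of _ _ f]) auto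
    qed
  qed
  moreover have "l2_norm m f \<le> (2 / s) * l2_norm m (?R f)" if "f \<in> l2 m" for f
  proof -
    have "sqrt (s\<^sup>2 * l2_sq f) \<le> sqrt (4 * l2_sq (?R f))" using bound(2)[OF that] by simp
    then have "s * l2_norm m f \<le> 2 * l2_norm m (?R f)"
      using s0 by (simp add: real_sqrt_mult l2_norm_eq)
    then show ?thesis using s0 by (simp add: field_simps)
  qed
  ultimately show ?thesis
    unfolding l2_resolvent_set_def bij_betw_def by blast
qed

section \<open>From the resolvent to the quadratic form\<close>

text \<open>With B = -\<Delta> - r, the bounds |v| \<le> C |Bv| and |Bv|^2 \<le> 2D <Bv, v> combine
  to |v|^2 \<le> 2D C^2 <Bv, v>, a spectral gap above \<open>r\<close>.\<close>

lemma resolvent_improves_coercive: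
  assumes r: "coercive r" "0 \<le> r"
    and res: "complex_of_real r \<in> l2_resolvent_set m (\<lambda>f x. - laplacian w m f x)"
  shows "\<exists>r'>r. coercive r'"
proof -
  obtain D where D: "0 < D" "\<And>x. deg w x \<le> D * m x" using deg_le_measure by blast
  obtain C where C: "\<And>f. f \<in> l2 m \<Longrightarrow>
      l2_norm m f \<le> C * l2_norm m (\<lambda>x. - laplacian w m f x - complex_of_real r * f x)"
    using res unfolding l2_resolvent_set_def by blast
  \<comment> \<open>C^2 + 1 in place of C^2 keeps \<open>M\<close> positive whatever
    \<open>C\<close> is.\<close>
  define M where "M = (C\<^sup>2 + 1) * (2 * D)"
  have M: "0 < M" using D(1) by (simp add: M_def add_nonneg_pos)
  have "(r + 1 / M) * mass S u \<le> dform S u u" if S: "finite S" for S u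
  proof -
    \<comment> \<open>\<open>u\<close> is arbitrary off \<open>S\<close>, so it is cut off first.
      With the neighbours added, \<open>S'\<close> also contains the support of \<open>h\<close>,
      and both l2 norms are finite sums over it.\<close>
    define v where "v = (\<lambda>x. if x \<in> S then u x else 0)"
    define S' where "S' = S \<union> (\<Union>x\<in>S. neighbors w x)"
    have S': "finite S'" "S \<subseteq> S'" using S locally_finite by (auto simp: S'_def)
    have v: "\<And>x. x \<notin> S' \<Longrightarrow> v x = 0" "\<And>x. x \<notin> S \<Longrightarrow> v x = 0" using S' by (auto simp: v_def)
    define h where "h = (\<lambda>x. - laplacian w m v x - r * v x)"
    have h: "h x = 0" if "x \<notin> S'" for x
    proof -
      have "v y = 0" if "y \<in> neighbors w x" for y
        using that \<open>x \<notin> S'\<close> weight_sym[of x y] by (auto simp: v_def S'_def neighbors_def)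
      then show ?thesis using v(1)[OF that] by (simp add: h_def laplacian_real)
    qed
    have ch: "(\<lambda>x. - laplacian w m (\<lambda>x. complex_of_real (v x)) x - complex_of_real r * complex_of_real (v x))
        = (\<lambda>x. complex_of_real (h x))"
      by (rule ext) (simp add: h_def laplacian_def scaleR_conv_of_real)
    have "l2_norm m (\<lambda>x. complex_of_real (v x)) \<le> C * l2_norm m (\<lambda>x. complex_of_real (h x))"
      using C[OF l2_finite_support(1)[of S' v]] S'(1) v(1) unfolding ch by simp
    then have "(l2_norm m (\<lambda>x. complex_of_real (v x)))\<^sup>2 \<le> (C * l2_norm m (\<lambda>x. complex_of_real (h x)))\<^sup>2"
      by (intro power_mono) (auto simp: l2_norm_eq l2_sq_nonneg)
    then have "mass S' v \<le> C\<^sup>2 * mass S' h"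
      using l2_finite_support(2)[OF S'(1), of v] l2_finite_support(2)[OF S'(1), of h] v h
      by (simp add: l2_norm_eq power_mult_distrib mass_nonneg)
    also have "\<dots> \<le> (C\<^sup>2 + 1) * mass S' h" by (intro mult_right_mono mass_nonneg) simp
    also have "\<dots> \<le> (C\<^sup>2 + 1) * (2 * D * (dform S' v v - r * mass S' v))"
      using mass_shifted_laplacian_le[OF r D S'(1) v(1)] unfolding h_def
      by (intro mult_left_mono) auto
    finally have "mass S' v \<le> M * (dform S' v v - r * mass S' v)" by (simp add: M_def)
    then have "(r + 1 / M) * mass S' v \<le> dform S' v v" using M by (simp add: field_simps)
    moreover have "mass S' v = mass S u"
      unfolding mass_def by (rule sum.mono_neutral_cong_right) (use S' in \<open>auto simp: v_def\<close>)
    moreover have "dform S' v v = dform S u u"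
    proof -
      have "(\<Sum>x\<in>S'. deg w x * v x * v x) = (\<Sum>x\<in>S. deg w x * u x * u x)"
        by (rule sum.mono_neutral_cong_right) (use S' in \<open>auto simp: v_def\<close>)
      moreover have "(\<Sum>x\<in>S'. \<Sum>y\<in>S'. w x y * v y * v x) = (\<Sum>x\<in>S. \<Sum>y\<in>S. w x y * u y * u x)"
      proof (rule sum.mono_neutral_cong_right[OF S'])
        fix x assume "x \<in> S"
        then show "(\<Sum>y\<in>S'. w x y * v y * v x) = (\<Sum>y\<in>S. w x y * u y * u x)"
          by (intro sum.mono_neutral_cong_right[OF S']) (auto simp: v_def)
      qed (simp add: v_def)
      ultimately show ?thesis by (simp add: dform_def)
    qed
    ultimately show ?thesis by simp
  qed
  then have "coercive (r + 1 / M)" by (simp add: coercive_def)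
  then show ?thesis using M by (intro exI[of _ "r + 1 / M"]) auto
qed

text \<open>For fixed \<open>S\<close> and \<open>u\<close> the inequality is closed in
  \<open>r\<close>, so the supremum inherits it; a point mass bounds the set.\<close>

lemma coercive_Sup:
  shows "coercive (Sup {r. coercive r})" "bdd_above {r. coercive r}"
proof -
  fix p :: 'v
  have "r \<le> deg w p / m p" if "coercive r" for r
    using coercive_imp_le_deg[OF that, of p] measure_pos[of p] by (simp add: field_simps)
  then show bdd: "bdd_above {r. coercive r}" by (auto simp: bdd_above_def)
  have "Sup {r. coercive r} * mass S u \<le> dform S u u" if S: "finite S" for S u
  proof (cases "mass S u = 0")
    case True
    then show ?thesis using coercive_0 S by (simp add: coercive_def)
  next
    case False
    then have pos: "0 < mass S u" using mass_nonneg[of S u] by simp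
    have "Sup {r. coercive r} \<le> dform S u u / mass S u"
    proof (rule cSup_least)
      show "{r. coercive r} \<noteq> {}" using coercive_0 by blast
      show "r \<le> dform S u u / mass S u" if "r \<in> {r. coercive r}" for r
        using that S pos by (simp add: coercive_def pos_le_divide_eq)
    qed
    then show ?thesis using pos by (simp add: pos_le_divide_eq)
  qed
  then show "coercive (Sup {r. coercive r})" by (simp add: coercive_def)
qed

text \<open>The best constant cannot lie in the resolvent set, since coercivity would then improve
  past it. It is thus a spectral value, and the infimum lies below it because the real spectral
  values are bounded below.\<close>

lemma spectrum_inf_le_coercive: "\<exists>r. coercive r \<and> spectrum_inf w m \<le> r"
proof -
  define r where "r = Sup {r. coercive r}"
  note cs = coercive_Sup[folded r_def]
  have r: "coercive r" by (rule cs)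
  have upper: "r' \<le> r" if "coercive r'" for r'
    unfolding r_def by (rule cSup_upper[OF _ cs(2)]) (use that in simp)
  have spec: "complex_of_real r \<in> l2_spectrum m (\<lambda>f x. - laplacian w m f x)"
    unfolding l2_spectrum_def
  proof
    assume "complex_of_real r \<in> l2_resolvent_set m (\<lambda>f x. - laplacian w m f x)"
    from resolvent_improves_coercive[OF r upper[OF coercive_0] this]
    obtain r' where "r < r'" "coercive r'" by blast
    with upper[of r'] show False by simp
  qed
  obtain D where D: "0 < D" "\<And>x. deg w x \<le> D * m x" using deg_le_measure by blast
  have "- (4 * D) \<le> t" if "complex_of_real t \<in> l2_spectrum m (\<lambda>f x. - laplacian w m f x)" for t
  proof (rule ccontr)
    assume "\<not> - (4 * D) \<le> t"
    then have "4 * D \<le> - t" by simp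
    from resolvent_far_left[OF D this] that show False by (simp add: l2_spectrum_def)
  qed
  then have "bdd_below {t. complex_of_real t \<in> l2_spectrum m (\<lambda>f x. - laplacian w m f x)}"
    by (auto simp: bdd_below_def)
  then have "spectrum_inf w m \<le> r"
    unfolding spectrum_inf_def by (intro cInf_lower) (simp_all add: spec)
  then show ?thesis using r by blast
qed

end

theorem theorem2p7:
  fixes w :: "'v \<Rightarrow> 'v \<Rightarrow> real" and m :: "'v \<Rightarrow> real" and K n :: real
  assumes "weighted_graph w m"
    and "0 \<le> K"
    and "0 < n"
    and "CDE w m n (- K)"
  shows "spectrum_inf w m \<le> K * n"
proof -
  interpret weighted_graph w m by fact
  obtain r where "coercive r" "spectrum_inf w m \<le> r" using spectrum_inf_le_coercive by blast
  with coercive_le[OF assms(4,2,3), of r] show ?thesis by simp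
qed

end
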